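(* Let $S$ be a left cancellative semigroup. The following two conditions are equivalent: (i) $S$ satisfies Clifford's condition. (ii) For every $s,t\in S$ with $t^{-1}(sS)$ nonempty, there is some $r\in S$ such that $t^{-1}(sS)=rS$. These conditions imply that $J(S)\cup\{\varnothing\}=\{sS:s\in S\}\cup\{\varnothing\}$ and that $J(S)$ is independent. If $S$ is algebraically ordered, then (i) is equivalent to the following statement: (iii) Every pair of elements in $S$ that have a common lower bound have a greatest lower bound. This implies that when $S$ is an algebraically ordered semigroup satisfying Clifford's condition, $(S^0,\wedge)$ is a semilattice and is isomorphic as a semilattice to $J(S)\cup\{\varnothing\}\simeq J(S)^0$.
   Context: A semigroup here means a set with an associative product and an identity element $1$ (a monoid). $S$ is left cancellative if $sr=st$ implies $r=t$ for all $s,r,t\in S$. For $X\subset S$ and $s\in S$, $sX=\{sx:x\in X\}$ and $s^{-1}(X)=s^{-1}X=\{t\in S: st\in X\}$. $S$ satisfies Clifford's condition if for any $s,t\in S$, either $sS\cap tS=\varnothing$ or there exists $r\in S$ such that $sS\cap tS=rS$. A semilattice is a commutative semigroup in which every element is idempotent. $J(S)$, the semilattice of constructible right ideals of $S$, is the set of all finite intersections of subsets of the form $t_1^{-1}s_1\cdots t_n^{-1}s_nS$ with $n\ge 1$ and $s_i,t_i\in S$ (the operations $X\mapsto sX$ and $X\mapsto t^{-1}X$ being applied successively from right to left); the product on $J(S)$, and on $J(S)\cup\{\varnothing\}$, is set intersection. $J(S)$ is called independent if for any $X_1,\dots,X_n,Y\in J(S)$, $\bigcup_{i=1}^n X_i=Y$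 implies $X_i=Y$ for at least one $1\le i\le n$. The preorder $\preceq$ on a semigroup $S$ is defined by $s\preceq t$ if there exists $r\in S$ with $s=tr$ (equivalently $sS\subset tS$). $S$ is algebraically ordered if $\preceq$ is antisymmetric, hence a partial order. Lower bounds and greatest lower bounds are taken with respect to $\preceq$, and $s\wedge t$ denotes the greatest lower bound of $s$ and $t$ if it exists. A zero element of a semigroup $P$ is an element $0\in P$ with $0p=p0=0$ for all $p\in P$. For any semigroup $P$, $P^0=P$ if $P$ already has a zero element, and otherwise $P^0=P\cup\{0\}$ with the product extended by $p0=0p=0$ for all $p\in P^0$.
   Formalization: The isomorphisms of S^0 with J(S)∪{∅} and of J(S)∪{∅} with J(S)^0 are stated for S ≠ {1}; for S = {1} they fail, since S^0 and J(S)^0 have one element and J(S)∪{∅} has two. *)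

theory Defs
  imports "HOL-Algebra.Coset"
begin

definition left_cancellative :: "('a, 'b) monoid_scheme \<Rightarrow> bool" where
  "left_cancellative S \<longleftrightarrow>
     (\<forall>s\<in>carrier S. \<forall>r\<in>carrier S. \<forall>t\<in>carrier S. s \<otimes>\<^bsub>S\<^esub> r = s \<otimes>\<^bsub>S\<^esub> t \<longrightarrow> r = t)"

(* left_quotient S t X is t^{-1}X; the translate sX is the library's left coset s <# X,
   so the principal right ideal sS is s <# carrier S. *)
definition left_quotient :: "('a, 'b) monoid_scheme \<Rightarrow> 'a \<Rightarrow> 'a set \<Rightarrow> 'a set" where
  "left_quotient S t X = {x \<in> carrier S. t \<otimes>\<^bsub>S\<^esub> x \<in> X}"

definition clifford_condition :: "('a, 'b) monoid_scheme \<Rightarrow> bool" where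
  "clifford_condition S \<longleftrightarrow>
     (\<forall>s\<in>carrier S. \<forall>t\<in>carrier S.
        (s <#\<^bsub>S\<^esub> carrier S) \<inter> (t <#\<^bsub>S\<^esub> carrier S) = {} \<or>
        (\<exists>r\<in>carrier S. (s <#\<^bsub>S\<^esub> carrier S) \<inter> (t <#\<^bsub>S\<^esub> carrier S) = r <#\<^bsub>S\<^esub> carrier S))"

(* The list [(t1, s1), ..., (tn, sn)] encodes t1^{-1} s1 ... tn^{-1} sn S. *)
definition word_ideal :: "('a, 'b) monoid_scheme \<Rightarrow> ('a \<times> 'a) list \<Rightarrow> 'a set" where
  "word_ideal S w = foldr (\<lambda>(t, s) X. left_quotient S t (s <#\<^bsub>S\<^esub> X)) w (carrier S)"

definition constructible_ideals :: "('a, 'b) monoid_scheme \<Rightarrow> 'a set set" where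
  "constructible_ideals S =
     {\<Inter>F | F. finite F \<and> F \<noteq> {} \<and>
        F \<subseteq> {word_ideal S w | w. w \<noteq> [] \<and> set w \<subseteq> carrier S \<times> carrier S}}"

(* The family X1, ..., Xn is nonempty: otherwise no family containing {} would be independent. *)
definition independent_family :: "'a set set \<Rightarrow> bool" where
  "independent_family J \<longleftrightarrow>
     (\<forall>F Y. finite F \<and> F \<noteq> {} \<and> F \<subseteq> J \<and> Y \<in> J \<and> \<Union>F = Y \<longrightarrow> (\<exists>X\<in>F. X = Y))"

definition alg_order :: "('a, 'b) monoid_scheme \<Rightarrow> 'a gorder" where
  "alg_order S = \<lparr>carrier = carrier S, eq = (=), le = (\<lambda>s t. \<exists>r\<in>carrier S. s = t \<otimes>\<^bsub>S\<^esub> r)\<rparr>"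

definition algebraically_ordered :: "('a, 'b) monoid_scheme \<Rightarrow> bool" where
  "algebraically_ordered S \<longleftrightarrow> antisymp_on (carrier S) (le (alg_order S))"

definition alg_glb :: "('a, 'b) monoid_scheme \<Rightarrow> 'a \<Rightarrow> 'a \<Rightarrow> 'a \<Rightarrow> bool" where
  "alg_glb S r s t \<longleftrightarrow> greatest (alg_order S) r (Lower (alg_order S) {s, t})"

definition is_zero :: "('a, 'b) monoid_scheme \<Rightarrow> 'a \<Rightarrow> bool" where
  "is_zero P z \<longleftrightarrow> z \<in> carrier P \<and> (\<forall>p\<in>carrier P. z \<otimes>\<^bsub>P\<^esub> p = z \<and> p \<otimes>\<^bsub>P\<^esub> z = z)"

(* P^0, with the elements of P tagged by Some. If P already has a zero, None is not in the
   carrier and the result is just the tagged copy of P. *)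
definition adjoin_zero :: "('a, 'b) monoid_scheme \<Rightarrow> 'a option monoid" where
  "adjoin_zero P =
     \<lparr>carrier = (if \<exists>z. is_zero P z then Some ` carrier P else insert None (Some ` carrier P)),
      mult = (\<lambda>x y. case (x, y) of (Some a, Some b) \<Rightarrow> Some (a \<otimes>\<^bsub>P\<^esub> b) | _ \<Rightarrow> None),
      one = Some \<one>\<^bsub>P\<^esub>\<rparr>"

definition semilattice_monoid :: "('a, 'b) monoid_scheme \<Rightarrow> bool" where
  "semilattice_monoid P \<longleftrightarrow> comm_monoid P \<and> (\<forall>x\<in>carrier P. x \<otimes>\<^bsub>P\<^esub> x = x)"

(* The library meet is a Hilbert choice of a greatest lower bound, so it is only meaningful
   where greatest lower bounds exist. *)
definition meet_monoid :: "('a, 'b) monoid_scheme \<Rightarrow> 'a monoid" where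
  "meet_monoid P = \<lparr>carrier = carrier P, mult = meet (alg_order P), one = \<one>\<^bsub>P\<^esub>\<rparr>"

definition ideal_semilattice :: "('a, 'b) monoid_scheme \<Rightarrow> 'a set monoid" where
  "ideal_semilattice S = \<lparr>carrier = constructible_ideals S, mult = (\<inter>), one = carrier S\<rparr>"

definition ideal_semilattice_empty :: "('a, 'b) monoid_scheme \<Rightarrow> 'a set monoid" where
  "ideal_semilattice_empty S =
     \<lparr>carrier = constructible_ideals S \<union> {{}}, mult = (\<inter>), one = carrier S\<rparr>"

end

(* Left cancellation gives the inverse of left translation by t: t^{-1}(tqS) = qS and
   t(t^{-1}(sS)) = sS \<inter> tS, so the two forms of Clifford's condition match and every word
   ideal is principal or empty. Greatest lower bounds for the algebraic preorder of any monoid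
   are exactly the generators of intersections of two principal right ideals; applied to S this
   gives (iii), applied to S^0 it shows that x \<mapsto> xS (with 0 \<mapsto> {}) turns meets into intersections.
   A left cancellative monoid with a zero is trivial, and so is an algebraically ordered one with
   a least principal right ideal zS, because then zs = z for all s. *)

theory Submission
  imports Defs
begin

section \<open>Preliminaries on cancellation, isomorphisms and zeros\<close>

lemma left_cancellativeD:
  assumes "left_cancellative S" "s \<in> carrier S" "r \<in> carrier S" "t \<in> carrier S"
    and "s \<otimes>\<^bsub>S\<^esub> r = s \<otimes>\<^bsub>S\<^esub> t"
  shows "r = t"
  using assms by (simp add: left_cancellative_def)

lemma is_isoI:
  assumes "inj_on h (carrier A)" "h ` carrier A = carrier B"
    and "\<And>x y. \<lbrakk>x \<in> carrier A; y \<in> carrier A\<rbrakk> \<Longrightarrow> h (x \<otimes>\<^bsub>A\<^esub> y) = h x \<otimes>\<^bsub>B\<^esub> h y"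
  shows "A \<cong> B"
proof -
  have "h \<in> iso A B" using assms by (auto simp: iso_def hom_def bij_betw_def)
  then show ?thesis by (auto simp: is_iso_def)
qed

lemma carrier_adjoin_zero_of_zero: "is_zero P z \<Longrightarrow> carrier (adjoin_zero P) = Some ` carrier P"
  by (auto simp: adjoin_zero_def)

section \<open>Principal right ideals\<close>

lemma mem_l_coset: "x \<in> a <#\<^bsub>S\<^esub> X \<longleftrightarrow> (\<exists>y\<in>X. x = a \<otimes>\<^bsub>S\<^esub> y)"
  by (auto simp: l_coset_def)

lemma l_coset_empty: "a <#\<^bsub>S\<^esub> {} = {}"
  by (auto simp: l_coset_def)

lemma left_quotient_empty: "left_quotient S t {} = {}"
  by (auto simp: left_quotient_def)

context monoid
begin

lemma gen_in_principal: "a \<in> carrier G \<Longrightarrow> a \<in> a <# carrier G"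
  by (auto simp: mem_l_coset intro: bexI[of _ \<one>])

lemma principal_nonempty: "a \<in> carrier G \<Longrightarrow> a <# carrier G \<noteq> {}"
  using gen_in_principal by blast

lemma principal_subset_carrier: "a \<in> carrier G \<Longrightarrow> a <# carrier G \<subseteq> carrier G"
  by (auto simp: mem_l_coset)

lemma principal_one: "\<one> <# carrier G = carrier G"
  by (auto simp: mem_l_coset)

lemma principal_subset_iff:
  assumes "a \<in> carrier G" "b \<in> carrier G"
  shows "a <# carrier G \<subseteq> b <# carrier G \<longleftrightarrow> a \<in> b <# carrier G"
proof
  assume "a <# carrier G \<subseteq> b <# carrier G"
  then show "a \<in> b <# carrier G" using gen_in_principal assms(1) by blast
next
  assume "a \<in> b <# carrier G"
  then obtain r where r: "r \<in> carrier G" "a = b \<otimes> r" by (auto simp: mem_l_coset)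
  then have "a \<otimes> y \<in> b <# carrier G" if "y \<in> carrier G" for y
    using that assms by (auto simp: mem_l_coset m_assoc intro!: bexI[of _ "r \<otimes> y"])
  then show "a <# carrier G \<subseteq> b <# carrier G" by (auto simp: mem_l_coset[where a=a])
qed

lemma l_coset_principal:
  assumes "a \<in> carrier G" "b \<in> carrier G"
  shows "a <# (b <# carrier G) = (a \<otimes> b) <# carrier G"
  using assms by (force simp: mem_l_coset m_assoc)

section \<open>The algebraic preorder and its greatest lower bounds\<close>

lemma le_alg_order: "le (alg_order G) a b \<longleftrightarrow> a \<in> b <# carrier G"
  by (simp add: alg_order_def mem_l_coset)

lemma Lower_alg_order:
  assumes "a \<in> carrier G" "b \<in> carrier G"
  shows "Lower (alg_order G) {a, b} = (a <# carrier G) \<inter> (b <# carrier G)"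
proof -
  have C: "carrier (alg_order G) = carrier G" by (simp add: alg_order_def)
  show ?thesis
    using assms principal_subset_carrier[of a] unfolding Lower_def le_alg_order C by blast
qed

text \<open>Lying below \<open>r\<close> means lying in \<open>r <# carrier G\<close>. So a greatest
  lower bound is an element of the right ideal of all common lower bounds whose own principal ideal
  exhausts it.\<close>

lemma alg_glb_iff:
  assumes "a \<in> carrier G" "b \<in> carrier G"
  shows "alg_glb G r a b \<longleftrightarrow>
    r \<in> carrier G \<and> r <# carrier G = (a <# carrier G) \<inter> (b <# carrier G)"
proof -
  let ?I = "(a <# carrier G) \<inter> (b <# carrier G)"
  have sub: "?I \<subseteq> carrier (alg_order G)"
    using principal_subset_carrier[of a] assms by (auto simp: alg_order_def)
  have "alg_glb G r a b \<longleftrightarrow> r \<in> ?I \<and> ?I \<subseteq> r <# carrier G"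
    using sub by (simp add: alg_glb_def greatest_def Lower_alg_order[OF assms] le_alg_order subset_iff Ball_def)
  also have "\<dots> \<longleftrightarrow> r \<in> carrier G \<and> r <# carrier G = ?I"
  proof
    assume r: "r \<in> ?I \<and> ?I \<subseteq> r <# carrier G"
    then have rG: "r \<in> carrier G" using principal_subset_carrier[OF assms(1)] by blast
    have "r <# carrier G \<subseteq> a <# carrier G" "r <# carrier G \<subseteq> b <# carrier G"
      using r rG principal_subset_iff assms by auto
    then show "r \<in> carrier G \<and> r <# carrier G = ?I" using r rG by blast
  next
    assume "r \<in> carrier G \<and> r <# carrier G = ?I"
    then show "r \<in> ?I \<and> ?I \<subseteq> r <# carrier G" using gen_in_principal[of r] by simp
  qed
  finally show ?thesis .
qed

text \<open>Each generator is below the other, and antisymmetry identifies them. This reduces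
  equations between elements to equations between ideals.\<close>

lemma principal_eqD:
  assumes "algebraically_ordered G" "a \<in> carrier G" "b \<in> carrier G"
    and "a <# carrier G = b <# carrier G"
  shows "a = b"
proof -
  have "le (alg_order G) a b" "le (alg_order G) b a"
    using assms gen_in_principal by (auto simp: le_alg_order)
  then show ?thesis using assms by (auto simp: algebraically_ordered_def antisymp_on_def)
qed

lemma algebraically_orderedI:
  assumes "\<And>a b. \<lbrakk>a \<in> carrier G; b \<in> carrier G; a <# carrier G = b <# carrier G\<rbrakk> \<Longrightarrow> a = b"
  shows "algebraically_ordered G"
  unfolding algebraically_ordered_def antisymp_on_def le_alg_order
  using assms principal_subset_iff by blast

lemma clifford_iff_glb:
  "clifford_condition G \<longleftrightarrow>
    (\<forall>s\<in>carrier G. \<forall>t\<in>carrier G. Lower (alg_order G) {s, t} \<noteq> {} \<longrightarrow> (\<exists>r. alg_glb G r s t))"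
proof -
  have "(\<exists>r. alg_glb G r s t) \<longleftrightarrow>
      (\<exists>r\<in>carrier G. (s <# carrier G) \<inter> (t <# carrier G) = r <# carrier G)"
    if "s \<in> carrier G" "t \<in> carrier G" for s t
    using alg_glb_iff[OF that] by metis
  then show ?thesis
    by (simp add: clifford_condition_def Lower_alg_order disj_imp cong: ball_cong)
qed

section \<open>Meets\<close>

text \<open>The choice behind \<open>meet\<close> meets its specification once some greatest lower
  bound exists.\<close>

lemma alg_glb_meet:
  assumes "\<exists>z. alg_glb G z x y"
  shows "alg_glb G (meet (alg_order G) x y) x y"
  using assms someI_ex[of "\<lambda>z. alg_glb G z x y"] by (simp add: meet_def inf_def alg_glb_def)

lemma principal_meet:
  assumes "x \<in> carrier G" "y \<in> carrier G" "\<exists>z. alg_glb G z x y"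
  shows "meet (alg_order G) x y \<in> carrier G"
    and "meet (alg_order G) x y <# carrier G = (x <# carrier G) \<inter> (y <# carrier G)"
  using alg_glb_meet[OF assms(3)] alg_glb_iff[OF assms(1,2)] by auto

text \<open>The map from \<open>x\<close> to \<open>x <# carrier G\<close> is injective by
  antisymmetry and turns \<open>meet\<close> into intersection, so the laws are inherited from sets.
  The unit generates the whole carrier, which is neutral for intersection.\<close>

lemma semilattice_meet_monoid:
  assumes ord: "algebraically_ordered G"
    and glb: "\<And>x y. \<lbrakk>x \<in> carrier G; y \<in> carrier G\<rbrakk> \<Longrightarrow> \<exists>z. alg_glb G z x y"
  shows "semilattice_monoid (meet_monoid G)"
proof -
  note m = principal_meet[OF _ _ glb]
  note eq = principal_eqD[OF ord]
  have "comm_monoid (meet_monoid G)"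
  proof (rule comm_monoidI)
    fix x y z assume "x \<in> carrier (meet_monoid G)" "y \<in> carrier (meet_monoid G)"
      "z \<in> carrier (meet_monoid G)"
    then show "x \<otimes>\<^bsub>meet_monoid G\<^esub> y \<otimes>\<^bsub>meet_monoid G\<^esub> z
        = x \<otimes>\<^bsub>meet_monoid G\<^esub> (y \<otimes>\<^bsub>meet_monoid G\<^esub> z)"
      by (auto simp: meet_monoid_def m intro!: eq)
  next
    fix x assume "x \<in> carrier (meet_monoid G)"
    then show "\<one>\<^bsub>meet_monoid G\<^esub> \<otimes>\<^bsub>meet_monoid G\<^esub> x = x"
      using principal_subset_carrier[of x]
      by (auto simp: meet_monoid_def m principal_one intro!: eq)
  next
    fix x y assume "x \<in> carrier (meet_monoid G)" "y \<in> carrier (meet_monoid G)"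
    then show "x \<otimes>\<^bsub>meet_monoid G\<^esub> y = y \<otimes>\<^bsub>meet_monoid G\<^esub> x"
      by (auto simp: meet_monoid_def m intro!: eq)
  qed (auto simp: meet_monoid_def m)
  moreover have "meet (alg_order G) x x = x" if "x \<in> carrier G" for x
    using that by (auto simp: m intro!: eq)
  ultimately show ?thesis by (auto simp: semilattice_monoid_def meet_monoid_def)
qed

section \<open>Clifford's condition and constructible ideals\<close>

lemma l_coset_left_quotient:
  "t <# left_quotient G t (s <# carrier G) = (s <# carrier G) \<inter> (t <# carrier G)"
  by (auto simp: mem_l_coset[where a=t] left_quotient_def)

text \<open>A left quotient by \<open>t\<close> only sees multiples of \<open>t\<close>. This
  replaces a principal ideal by an intersection to which Clifford's condition applies.\<close>

lemma left_quotient_Int_principal: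
  "left_quotient G t (X \<inter> (t <# carrier G)) = left_quotient G t X"
  by (auto simp: left_quotient_def mem_l_coset)

text \<open>Cancelling \<open>t\<close> turns
  \<open>t \<otimes> x = (t \<otimes> q) \<otimes> y\<close> into
  \<open>x = q \<otimes> y\<close>.\<close>

lemma left_quotient_principal:
  assumes "left_cancellative G" "t \<in> carrier G" "q \<in> carrier G"
  shows "left_quotient G t ((t \<otimes> q) <# carrier G) = q <# carrier G"
proof -
  have "t \<otimes> x = (t \<otimes> q) \<otimes> y \<longleftrightarrow> x = q \<otimes> y" if "x \<in> carrier G" "y \<in> carrier G" for x y
    using left_cancellativeD[OF assms(1,2) that(1), of "q \<otimes> y"] that assms(2,3)
    by (auto simp: m_assoc)
  then show ?thesis
    using principal_subset_carrier[OF assms(3)] by (auto simp: left_quotient_def mem_l_coset)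
qed

text \<open>The generator \<open>r\<close> of the intersection of the two ideals lies in
  \<open>t <# carrier G\<close>, so it factors as \<open>t \<otimes> q\<close>; cancelling
  \<open>t\<close> shows that \<open>q\<close> generates the quotient.\<close>

lemma clifford_left_quotient:
  assumes lc: "left_cancellative G" and cl: "clifford_condition G"
    and st: "s \<in> carrier G" "t \<in> carrier G" and ne: "left_quotient G t (s <# carrier G) \<noteq> {}"
  shows "\<exists>r\<in>carrier G. left_quotient G t (s <# carrier G) = r <# carrier G"
proof -
  have "(s <# carrier G) \<inter> (t <# carrier G) \<noteq> {}"
    using ne left_quotient_Int_principal[of t "s <# carrier G"] left_quotient_empty by metis
  then obtain r where r: "r \<in> carrier G"
    "(s <# carrier G) \<inter> (t <# carrier G) = r <# carrier G"
    using cl st unfolding clifford_condition_def by blast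
  then have "r \<in> t <# carrier G"
    using gen_in_principal[of r] by blast
  then obtain q where q: "q \<in> carrier G" "r = t \<otimes> q"
    by (auto simp: mem_l_coset)
  have "left_quotient G t (s <# carrier G) = q <# carrier G"
    using left_quotient_Int_principal[of t "s <# carrier G"]
      left_quotient_principal[OF lc st(2) q(1)] r(2) q(2) by simp
  then show ?thesis using q(1) by blast
qed

lemma clifford_iff_left_quotient:
  assumes "left_cancellative G"
  shows "clifford_condition G \<longleftrightarrow>
    (\<forall>s\<in>carrier G. \<forall>t\<in>carrier G. left_quotient G t (s <# carrier G) \<noteq> {} \<longrightarrow>
       (\<exists>r\<in>carrier G. left_quotient G t (s <# carrier G) = r <# carrier G))"
    (is "_ \<longleftrightarrow> ?Q")
proof
  assume "clifford_condition G"
  then show ?Q using clifford_left_quotient assms by blast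
next
  assume Q: ?Q
  show "clifford_condition G"
    unfolding clifford_condition_def
  proof (intro ballI)
    fix s t assume st: "s \<in> carrier G" "t \<in> carrier G"
    \<comment> \<open>Translating the quotient back by \<open>t\<close> recovers the intersection: a
      generator \<open>r\<close> of the former yields the generator \<open>t \<otimes> r\<close> of
      the latter, and emptiness carries over.\<close>
    have eq: "t <# left_quotient G t (s <# carrier G) = (s <# carrier G) \<inter> (t <# carrier G)"
      using l_coset_left_quotient st by blast
    show "(s <# carrier G) \<inter> (t <# carrier G) = {} \<or>
      (\<exists>r\<in>carrier G. (s <# carrier G) \<inter> (t <# carrier G) = r <# carrier G)"
    proof (cases "left_quotient G t (s <# carrier G) = {}")
      case True
      then show ?thesis using eq by (simp add: l_coset_empty)
    next
      case False
      then obtain r where "r \<in> carrier G" "left_quotient G t (s <# carrier G) = r <# carrier G"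
        using Q st by blast
      then have "(s <# carrier G) \<inter> (t <# carrier G) = (t \<otimes> r) <# carrier G" "t \<otimes> r \<in> carrier G"
        using eq l_coset_principal[of t r] st by simp_all
      then show ?thesis by blast
    qed
  qed
qed

section \<open>Words and constructible ideals\<close>

lemma word_ideal_clifford:
  assumes lc: "left_cancellative G" and cl: "clifford_condition G"
    and "set w \<subseteq> carrier G \<times> carrier G"
  shows "word_ideal G w \<in> {s <# carrier G | s. s \<in> carrier G} \<union> {{}}"
  using assms(3)
proof (induction w)
  case Nil
  \<comment> \<open>Admitting the empty word lets the induction start from the whole monoid, the
    principal ideal of \<open>\<one>\<close>.\<close>
  have "word_ideal G [] = \<one> <# carrier G" by (simp add: word_ideal_def principal_one)
  then show ?case using one_closed by blast
next
  case (Cons p w)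
  obtain t s where p: "p = (t, s)" by (cases p)
  with Cons have ts: "t \<in> carrier G" "s \<in> carrier G" by auto
  have w: "word_ideal G (p # w) = left_quotient G t (s <# word_ideal G w)"
    by (simp add: word_ideal_def p)
  consider "word_ideal G w = {}" | a where "a \<in> carrier G" "word_ideal G w = a <# carrier G"
    using Cons.IH Cons.prems by force
  then show ?case
  proof cases
    case 1
    then show ?thesis by (simp add: w l_coset_empty left_quotient_empty)
  next
    case 2
    then have "word_ideal G (p # w) = left_quotient G t ((s \<otimes> a) <# carrier G)"
      using w l_coset_principal ts by simp
    then show ?thesis
      using clifford_left_quotient[OF lc cl _ ts(1), of "s \<otimes> a"] ts 2 by blast
  qed
qed

lemma constructible_ideals_Int:
  assumes "X \<in> constructible_ideals G" "Y \<in> constructible_ideals G"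
  shows "X \<inter> Y \<in> constructible_ideals G"
proof -
  let ?W = "{word_ideal G w | w. w \<noteq> [] \<and> set w \<subseteq> carrier G \<times> carrier G}"
  obtain F H where "X = \<Inter>F" "finite F" "F \<noteq> {}" "F \<subseteq> ?W" "Y = \<Inter>H" "finite H" "H \<noteq> {}" "H \<subseteq> ?W"
    using assms unfolding constructible_ideals_def by blast
  then have "X \<inter> Y = \<Inter>(F \<union> H)" "finite (F \<union> H)" "F \<union> H \<noteq> {}" "F \<union> H \<subseteq> ?W" by auto
  then show ?thesis unfolding constructible_ideals_def by blast
qed

lemma principal_constructible:
  assumes "s \<in> carrier G"
  shows "s <# carrier G \<in> constructible_ideals G"
proof -
  \<comment> \<open>Words are nonempty and each letter carries a quotient, so the harmless quotient
    by \<open>\<one>\<close> is inserted.\<close>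
  have "word_ideal G [(\<one>, s)] = s <# carrier G"
    using assms by (force simp: word_ideal_def left_quotient_def mem_l_coset)
  then have "s <# carrier G \<in> {word_ideal G w | w. w \<noteq> [] \<and> set w \<subseteq> carrier G \<times> carrier G}"
    using assms by (auto intro!: exI[of _ "[(\<one>, s)]"])
  then show ?thesis
    unfolding constructible_ideals_def by (auto intro!: exI[of _ "{s <# carrier G}"])
qed

text \<open>Clifford's condition closes the principal ideals together with \<open>{}\<close> under
  binary, hence finite, intersections. The empty set is added on both sides since it may or may not
  be constructible.\<close>

lemma constructible_ideals_clifford:
  assumes lc: "left_cancellative G" and cl: "clifford_condition G"
  shows "constructible_ideals G \<union> {{}} = {s <# carrier G | s. s \<in> carrier G} \<union> {{}}"
    (is "_ = ?P")
proof -
  have Int: "X \<inter> Y \<in> ?P" if "X \<in> ?P" "Y \<in> ?P" for X Y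
    using that cl unfolding clifford_condition_def by auto
  have "\<Inter>F \<in> ?P" if "finite F" "F \<noteq> {}" "F \<subseteq> ?P" for F
    using that
  proof (induction rule: finite_ne_induct)
    case (insert X F)
    then show ?case using Int[of X "\<Inter>F"] by simp
  qed auto
  moreover have "F \<subseteq> ?P"
    if "F \<subseteq> {word_ideal G w | w. w \<noteq> [] \<and> set w \<subseteq> carrier G \<times> carrier G}" for F
    using that word_ideal_clifford[OF lc cl] by fast
  ultimately have "X \<in> ?P" if "X \<in> constructible_ideals G" for X
    using that unfolding constructible_ideals_def by (smt (verit) mem_Collect_eq)
  then show ?thesis using principal_constructible by auto
qed

text \<open>A generator of \<open>Y\<close> lies in some member \<open>X\<close> of the union. This
  \<open>X\<close> is nonempty, hence principal, so it contains all of \<open>Y\<close>.\<close>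

lemma independent_constructible_ideals:
  assumes "left_cancellative G" and "clifford_condition G"
  shows "independent_family (constructible_ideals G)"
  unfolding independent_family_def
proof (intro allI impI)
  fix F Y
  assume A: "finite F \<and> F \<noteq> {} \<and> F \<subseteq> constructible_ideals G \<and> Y \<in> constructible_ideals G \<and> \<Union>F = Y"
  note J = constructible_ideals_clifford[OF assms]
  show "\<exists>X\<in>F. X = Y"
  proof (cases "Y = {}")
    \<comment> \<open>An empty union has only empty members, and \<open>F\<close> has at least
      one.\<close>
    case True
    then show ?thesis using A by blast
  next
    case False
    then obtain s where s: "s \<in> carrier G" "Y = s <# carrier G" using A J by blast
    then obtain X where X: "X \<in> F" "s \<in> X" using A gen_in_principal by blast
    then obtain r where r: "r \<in> carrier G" "X = r <# carrier G" using A J by blast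
    have "Y \<subseteq> X" using principal_subset_iff[of s r] s r X by blast
    then show ?thesis using X A by blast
  qed
qed

section \<open>Adjoining a zero\<close>

text \<open>Cancel \<open>z\<close> in \<open>z \<otimes> p = z = z \<otimes> \<one>\<close>. This
  decides when \<open>adjoin_zero\<close> really adds \<open>None\<close>.\<close>

lemma left_cancellative_zero_iff:
  assumes "left_cancellative G"
  shows "(\<exists>z. is_zero G z) \<longleftrightarrow> carrier G = {\<one>}"
proof
  assume "\<exists>z. is_zero G z"
  then obtain z where z: "is_zero G z" ..
  have "p = \<one>" if "p \<in> carrier G" for p
  proof -
    have "z \<in> carrier G" "z \<otimes> p = z \<otimes> \<one>" using z that by (auto simp: is_zero_def)
    then show ?thesis using left_cancellativeD[OF assms _ that one_closed] by blast
  qed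
  then show "carrier G = {\<one>}" by auto
qed (auto simp: is_zero_def)

lemma monoid_adjoin_zero: "monoid (adjoin_zero G)"
  by (rule monoidI) (auto simp: adjoin_zero_def m_assoc split: if_splits)

lemma carrier_adjoin_zero:
  assumes "\<nexists>z. is_zero G z"
  shows "carrier (adjoin_zero G) = insert None (Some ` carrier G)"
  using assms by (simp add: adjoin_zero_def)

lemma principal_adjoin_zero:
  assumes "\<nexists>z. is_zero G z"
  shows "None <#\<^bsub>adjoin_zero G\<^esub> carrier (adjoin_zero G) = {None}"
    and "Some a <#\<^bsub>adjoin_zero G\<^esub> carrier (adjoin_zero G) = insert None (Some ` (a <# carrier G))"
  unfolding carrier_adjoin_zero[OF assms] by (auto simp: adjoin_zero_def l_coset_def)

lemma algebraically_ordered_adjoin_zero: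
  assumes "algebraically_ordered G" "\<nexists>z. is_zero G z"
  shows "algebraically_ordered (adjoin_zero G)"
proof (rule monoid.algebraically_orderedI[OF monoid_adjoin_zero])
  note C = carrier_adjoin_zero[OF assms(2)]
  note P = principal_adjoin_zero[OF assms(2), unfolded C]
  \<comment> \<open>The instance with \<open>A\<close> empty separates \<open>None\<close> from
    tagged elements, since no principal ideal of \<open>G\<close> is empty.\<close>
  have eq: "insert None (Some ` A) = insert None (Some ` B) \<longleftrightarrow> A = B" for A B :: "'a set"
    by (auto simp: set_eq_iff image_iff)
  fix x y
  assume "x \<in> carrier (adjoin_zero G)" "y \<in> carrier (adjoin_zero G)"
    "x <#\<^bsub>adjoin_zero G\<^esub> carrier (adjoin_zero G) = y <#\<^bsub>adjoin_zero G\<^esub> carrier (adjoin_zero G)"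
  then show "x = y"
    using principal_eqD[OF assms(1)] principal_nonempty principal_nonempty[symmetric] eq[of "{}"]
    by (auto simp: C P eq)
qed

text \<open>Every principal ideal now contains \<open>None\<close>, so ideals disjoint in
  \<open>G\<close> intersect in \<open>{None}\<close>, which \<open>None\<close> generates.\<close>

lemma adjoin_zero_glb:
  assumes cl: "clifford_condition G" and nz: "\<nexists>z. is_zero G z"
    and xy: "x \<in> carrier (adjoin_zero G)" "y \<in> carrier (adjoin_zero G)"
  shows "\<exists>z. alg_glb (adjoin_zero G) z x y"
proof -
  let ?P = "\<lambda>z. z <#\<^bsub>adjoin_zero G\<^esub> carrier (adjoin_zero G)"
  note C = carrier_adjoin_zero[OF nz]
  note simps = C principal_adjoin_zero[OF nz, unfolded C]
  have "\<exists>z\<in>carrier (adjoin_zero G). ?P z = ?P x \<inter> ?P y"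
  proof (cases "x = None \<or> y = None")
    case True
    then have "?P None = ?P x \<inter> ?P y" using xy by (auto simp: simps)
    then show ?thesis by (intro bexI[of _ None]) (auto simp: simps)
  next
    case False
    then obtain a b where ab: "x = Some a" "y = Some b" "a \<in> carrier G" "b \<in> carrier G"
      using xy by (auto simp: simps)
    have I: "?P x \<inter> ?P y = insert None (Some ` ((a <# carrier G) \<inter> (b <# carrier G)))"
      by (auto simp: ab simps)
    consider "(a <# carrier G) \<inter> (b <# carrier G) = {}"
      | r where "r \<in> carrier G" "(a <# carrier G) \<inter> (b <# carrier G) = r <# carrier G"
      using cl ab unfolding clifford_condition_def by blast
    then show ?thesis
    proof cases
      case 1
      then show ?thesis unfolding I by (intro bexI[of _ None]) (auto simp: simps)
    next
      case 2
      then show ?thesis unfolding I by (intro bexI[of _ "Some r"]) (auto simp: simps)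
    qed
  qed
  then show ?thesis using monoid.alg_glb_iff[OF monoid_adjoin_zero xy] by blast
qed

section \<open>Isomorphisms with the semilattice of constructible ideals\<close>

lemma meet_adjoin_zero_iso:
  assumes lc: "left_cancellative G" and cl: "clifford_condition G"
    and ord: "algebraically_ordered G" and nz: "\<nexists>z. is_zero G z"
  shows "meet_monoid (adjoin_zero G) \<cong> ideal_semilattice_empty G"
proof -
  let ?C = "carrier (adjoin_zero G)"
  \<comment> \<open>The principal ideal of \<open>x\<close> with \<open>None\<close> and the tags
    removed: \<open>None\<close> goes to \<open>{}\<close>, and intersections are preserved.\<close>
  let ?h = "\<lambda>x. {y. Some y \<in> x <#\<^bsub>adjoin_zero G\<^esub> ?C}"
  note C = carrier_adjoin_zero[OF nz]
  note J = constructible_ideals_clifford[OF lc cl]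
  have h: "?h None = {}" "\<And>a. ?h (Some a) = a <# carrier G"
    by (auto simp: principal_adjoin_zero[OF nz])
  have img: "?h ` ?C = constructible_ideals G \<union> {{}}"
    unfolding J using h by (auto simp: C[symmetric] image_iff) (auto simp: C)
  have "inj_on ?h ?C"
  proof (rule inj_onI)
    fix x y assume "x \<in> ?C" "y \<in> ?C" and eq: "?h x = ?h y"
    then have "x = None \<or> (\<exists>a\<in>carrier G. x = Some a)" "y = None \<or> (\<exists>a\<in>carrier G. y = Some a)"
      by (auto simp: C)
    then show "x = y"
      using eq principal_eqD[OF ord] principal_nonempty principal_nonempty[symmetric]
      by (elim disjE bexE) (simp_all only: h, simp_all)
  qed
  moreover have "?h (meet (alg_order (adjoin_zero G)) x y) = ?h x \<inter> ?h y"
    if "x \<in> ?C" "y \<in> ?C" for x y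
    using monoid.principal_meet(2)[OF monoid_adjoin_zero that adjoin_zero_glb[OF cl nz that]] by auto
  ultimately show ?thesis
    using img by (intro is_isoI[of ?h]) (simp_all add: meet_monoid_def ideal_semilattice_empty_def)
qed

text \<open>A zero would be a least constructible ideal, principal because nonempty. With generator
  \<open>z\<close>, every \<open>z \<otimes> s\<close> generates it too, so antisymmetry and then
  cancellation give \<open>s = \<one>\<close>.\<close>

lemma constructible_ideals_no_zero:
  assumes lc: "left_cancellative G" and cl: "clifford_condition G"
    and ord: "algebraically_ordered G" and nontriv: "carrier G \<noteq> {\<one>}"
    and ne: "{} \<notin> constructible_ideals G"
  shows "\<nexists>Z. is_zero (ideal_semilattice G) Z"
proof
  assume "\<exists>Z. is_zero (ideal_semilattice G) Z"
  then obtain Z where Z: "Z \<in> constructible_ideals G" "\<And>X. X \<in> constructible_ideals G \<Longrightarrow> Z \<inter> X = Z"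
    by (auto simp: is_zero_def ideal_semilattice_def)
  obtain z where z: "z \<in> carrier G" "Z = z <# carrier G"
    using Z(1) ne constructible_ideals_clifford[OF lc cl] by blast
  have "s = \<one>" if s: "s \<in> carrier G" for s
  proof -
    have "z <# carrier G \<subseteq> (z \<otimes> s) <# carrier G"
      using Z(2)[OF principal_constructible[of "z \<otimes> s"]] z s by auto
    moreover have "(z \<otimes> s) <# carrier G \<subseteq> z <# carrier G"
      using principal_subset_iff[of "z \<otimes> s" z] z s by (auto simp: mem_l_coset)
    ultimately have "(z \<otimes> s) <# carrier G = z <# carrier G" by blast
    then have "z \<otimes> s = z \<otimes> \<one>"
      using principal_eqD[OF ord _ z(1), of "z \<otimes> s"] z(1) s by simp
    then show ?thesis by (rule left_cancellativeD[OF lc z(1) s one_closed])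
  qed
  then show False using nontriv by auto
qed

text \<open>If \<open>{}\<close> is constructible, it is the zero and \<open>adjoin_zero\<close>
  only tags. Otherwise a zero is really adjoined, and \<open>None\<close> plays the role of
  \<open>{}\<close>.\<close>

lemma ideal_semilattice_empty_iso:
  assumes lc: "left_cancellative G" and cl: "clifford_condition G"
    and ord: "algebraically_ordered G" and nontriv: "carrier G \<noteq> {\<one>}"
  shows "ideal_semilattice_empty G \<cong> adjoin_zero (ideal_semilattice G)"
proof (cases "{} \<in> constructible_ideals G")
  case True
  then have "\<exists>Z. is_zero (ideal_semilattice G) Z"
    by (auto simp: is_zero_def ideal_semilattice_def)
  then show ?thesis
    using True
    by (intro is_isoI[of Some]) (auto simp: adjoin_zero_def ideal_semilattice_def
        ideal_semilattice_empty_def insert_absorb)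
next
  case False
  let ?h = "\<lambda>X. if X = {} then None else Some X"
  have nz: "\<nexists>Z. is_zero (ideal_semilattice G) Z"
    using constructible_ideals_no_zero[OF assms False] .
  \<comment> \<open>This keeps \<open>?h\<close> multiplicative: no product of constructible ideals
    is sent to \<open>None\<close>.\<close>
  have ne: "X \<inter> Y \<noteq> {}" if "X \<in> constructible_ideals G" "Y \<in> constructible_ideals G" for X Y
    using constructible_ideals_Int[OF that] False by metis
  have "inj_on ?h (constructible_ideals G \<union> {{}})"
    by (auto simp: inj_on_def split: if_splits)
  moreover have "?h ` (constructible_ideals G \<union> {{}}) = insert None (Some ` constructible_ideals G)"
    using False by (auto simp: image_iff)
  ultimately show ?thesis
    using nz ne
    by (intro is_isoI[of ?h])
      (auto simp: adjoin_zero_def ideal_semilattice_def ideal_semilattice_empty_def)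
qed

text \<open>The unit is already a zero, so no new one is adjoined on either side and both
  semilattices have one element.\<close>

lemma trivial_adjoin_zero:
  assumes triv: "carrier G = {\<one>}"
  shows "\<forall>x\<in>carrier (adjoin_zero G). \<forall>y\<in>carrier (adjoin_zero G).
      \<exists>z. alg_glb (adjoin_zero G) z x y"
    and "algebraically_ordered (adjoin_zero G)"
    and "meet_monoid (adjoin_zero G) \<cong> adjoin_zero (ideal_semilattice G)"
proof -
  interpret P: monoid "adjoin_zero G" by (rule monoid_adjoin_zero)
  have lc: "left_cancellative G" using triv by (simp add: left_cancellative_def)
  have z: "\<exists>z. is_zero G z" using left_cancellative_zero_iff[OF lc] triv by blast
  have c: "carrier (adjoin_zero G) = {Some \<one>}" using z by (simp add: adjoin_zero_def triv)
  show glb: "\<forall>x\<in>carrier (adjoin_zero G). \<forall>y\<in>carrier (adjoin_zero G).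
      \<exists>z. alg_glb (adjoin_zero G) z x y"
    using c P.alg_glb_iff by auto
  show "algebraically_ordered (adjoin_zero G)"
    by (rule P.algebraically_orderedI) (auto simp: c)
  \<comment> \<open>Closure under \<open>meet\<close> determines the value on a one-element
    carrier.\<close>
  have m: "meet (alg_order (adjoin_zero G)) (Some \<one>) (Some \<one>) = Some \<one>"
    using P.principal_meet(1)[of "Some \<one>" "Some \<one>"] glb c by auto
  have w: "word_ideal G w = {\<one>}" if "set w \<subseteq> carrier G \<times> carrier G" for w
    using that by (induction w) (auto simp: word_ideal_def triv left_quotient_def l_coset_def)
  have "constructible_ideals G \<subseteq> {{\<one>}}"
    unfolding constructible_ideals_def using w by (auto 0 3)
  then have J: "constructible_ideals G = {{\<one>}}"
    using principal_constructible[OF one_closed] by auto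
  have "is_zero (ideal_semilattice G) {\<one>}"
    by (simp add: is_zero_def ideal_semilattice_def J)
  then have "carrier (adjoin_zero (ideal_semilattice G)) = {Some {\<one>}}"
    using carrier_adjoin_zero_of_zero by (fastforce simp: ideal_semilattice_def J)
  moreover have "Some {\<one>} \<otimes>\<^bsub>adjoin_zero (ideal_semilattice G)\<^esub> Some {\<one>} = Some {\<one>}"
    by (simp add: adjoin_zero_def ideal_semilattice_def)
  ultimately show "meet_monoid (adjoin_zero G) \<cong> adjoin_zero (ideal_semilattice G)"
    using c m by (intro is_isoI[of "\<lambda>_. Some {\<one>}"]) (simp_all add: meet_monoid_def)
qed

end

text \<open>The isomorphisms with \<open>ideal_semilattice_empty S\<close> are restricted to
  nontrivial \<open>S\<close>: for \<open>S\<close> trivial, \<open>adjoin_zero S\<close> has one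
  element but \<open>ideal_semilattice_empty S\<close> has two. Existence of greatest lower bounds
  is asserted separately because it gives \<open>meet\<close> its meaning.\<close>

theorem proposition2p3p5:
  fixes S :: "('a, 'b) monoid_scheme" (structure)
  assumes "monoid S" and "left_cancellative S"
  shows
    "(clifford_condition S \<longleftrightarrow>
       (\<forall>s\<in>carrier S. \<forall>t\<in>carrier S. left_quotient S t (s <# carrier S) \<noteq> {} \<longrightarrow>
          (\<exists>r\<in>carrier S. left_quotient S t (s <# carrier S) = r <# carrier S))) \<and>
     (clifford_condition S \<longrightarrow>
       constructible_ideals S \<union> {{}} = {s <# carrier S | s. s \<in> carrier S} \<union> {{}} \<and>
       independent_family (constructible_ideals S)) \<and>
     (algebraically_ordered S \<longrightarrow>
       (clifford_condition S \<longleftrightarrow>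
         (\<forall>s\<in>carrier S. \<forall>t\<in>carrier S. Lower (alg_order S) {s, t} \<noteq> {} \<longrightarrow>
            (\<exists>r. alg_glb S r s t)))) \<and>
     (algebraically_ordered S \<and> clifford_condition S \<longrightarrow>
       (\<forall>x\<in>carrier (adjoin_zero S). \<forall>y\<in>carrier (adjoin_zero S).
          \<exists>z. alg_glb (adjoin_zero S) z x y) \<and>
       semilattice_monoid (meet_monoid (adjoin_zero S)) \<and>
       meet_monoid (adjoin_zero S) \<cong> adjoin_zero (ideal_semilattice S) \<and>
       (carrier S \<noteq> {\<one>} \<longrightarrow>
          meet_monoid (adjoin_zero S) \<cong> ideal_semilattice_empty S \<and>
          ideal_semilattice_empty S \<cong> adjoin_zero (ideal_semilattice S)))"
proof -
  interpret monoid S by fact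
  note lc = assms(2)
  have "\<forall>x\<in>carrier (adjoin_zero S). \<forall>y\<in>carrier (adjoin_zero S). \<exists>z. alg_glb (adjoin_zero S) z x y"
      (is ?glb)
    and "semilattice_monoid (meet_monoid (adjoin_zero S))"
    and "meet_monoid (adjoin_zero S) \<cong> adjoin_zero (ideal_semilattice S)"
    and "carrier S \<noteq> {\<one>} \<longrightarrow>
          meet_monoid (adjoin_zero S) \<cong> ideal_semilattice_empty S \<and>
          ideal_semilattice_empty S \<cong> adjoin_zero (ideal_semilattice S)"
    if ord: "algebraically_ordered S" and cl: "clifford_condition S"
  proof -
    \<comment> \<open>Antisymmetry after adjoining the zero is carried along for the semilattice
      claim.\<close>
    have *: "?glb \<and> algebraically_ordered (adjoin_zero S) \<and>
      meet_monoid (adjoin_zero S) \<cong> adjoin_zero (ideal_semilattice S) \<and>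
      (carrier S \<noteq> {\<one>} \<longrightarrow>
          meet_monoid (adjoin_zero S) \<cong> ideal_semilattice_empty S \<and>
          ideal_semilattice_empty S \<cong> adjoin_zero (ideal_semilattice S))"
    proof (cases "carrier S = {\<one>}")
      case True
      then show ?thesis using trivial_adjoin_zero by blast
    next
      case False
      then have nz: "\<nexists>z. is_zero S z" using left_cancellative_zero_iff[OF lc] by blast
      \<comment> \<open>The isomorphism onto \<open>adjoin_zero (ideal_semilattice S)\<close> is the
        composite through \<open>ideal_semilattice_empty S\<close>.\<close>
      show ?thesis
        using adjoin_zero_glb[OF cl nz] algebraically_ordered_adjoin_zero[OF ord nz]
          meet_adjoin_zero_iso[OF lc cl ord nz] ideal_semilattice_empty_iso[OF lc cl ord False]
          iso_trans by blast
    qed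
    then show ?glb
      and "meet_monoid (adjoin_zero S) \<cong> adjoin_zero (ideal_semilattice S)"
      and "carrier S \<noteq> {\<one>} \<longrightarrow>
          meet_monoid (adjoin_zero S) \<cong> ideal_semilattice_empty S \<and>
          ideal_semilattice_empty S \<cong> adjoin_zero (ideal_semilattice S)"
      by blast+
    show "semilattice_monoid (meet_monoid (adjoin_zero S))"
      using monoid.semilattice_meet_monoid[OF monoid_adjoin_zero] * by blast
  qed
  then show ?thesis
    using clifford_iff_left_quotient[OF lc] clifford_iff_glb constructible_ideals_clifford[OF lc]
      independent_constructible_ideals[OF lc] by (intro conjI impI) simp_all
qed

end
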